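(* Let $\mathsf W\in\mathbb R^{N\times N}$ be a symmetric matrix, let $F\subset[1,N]^2$ be such that $\mathsf W_{ij}=0$ for all $(i,j)\in F$, and let $\mathsf K=f(\mathsf W)$ where $f$ is an injective analytic function on the real line. Let $S^\star=\operatorname{Supp}(\mathsf W)$. For $n\ge1$ let $\widehat{\mathsf K}=\widehat{\mathsf K}_n$ be a random matrix in $\mathbb R^{N\times N}$ such that $$\forall t>0,\quad \mathbb P\{\|\widehat{\mathsf K}-\mathsf K\|\ge t\}\le R_n(t),$$ where $t\mapsto R_n(t)$ is non-increasing and, for all $t>0$, $R_n(t)\to0$ as $n\to\infty$. Let $\lambda_n>0$, define for $S\subseteq\overline F$ $$Q(S)=\min_{\mathsf A\in\mathcal E(S)\setminus\{0\}}\frac{\|\mathsf A\widehat{\mathsf K}-\widehat{\mathsf K}\mathsf A\|}{\|\mathsf A\|}+\lambda_n|S|,$$ and let $\widehat S\in\arg\min_{S\subseteq\overline F}Q(S)$. If $\mathsf W$ is $F$-identifiable, then $$\mathbb P\{\widehat S\neq S^\star\}\le R_n\Big(\frac{c_0(S^\star)-\lambda_n|S^\star|}{4}\Big)+R_n\Big(\frac{\lambda_n}{2}\Big),$$ where $$c_0(S^\star):=\min_{\substack{S\subseteq\overline F,\ S\neq S^\star\\ |S|\le|S^\star|}}\ \min_{\mathsf A\in\mathcal E(S)\setminus\{0\}}\frac{\|\mathsf A\mathsf K-\mathsf K\mathsf A\|}{\|\mathsf A\|}>0.$$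
   Context: $[1,N]=\{1,\dots,N\}$; $\overline F=[1,N]^2\setminus F$; $\|\cdot\|$ is the Frobenius norm; $|S|$ is cardinality; $\operatorname{Supp}(\mathsf A)=\{(i,j):\mathsf A_{ij}\ne0\}$. $\mathcal E(S)$ is the set of real symmetric $N\times N$ matrices $\mathsf A$ with $\operatorname{Supp}(\mathsf A)\subseteq S$. $f(\mathsf W)$ is defined by applying $f$ to the eigenvalues of $\mathsf W$ (if $\mathsf W=UDU^\top$ with $U$ orthogonal and $D$ diagonal, then $f(\mathsf W)=Uf(D)U^\top$). The symmetric matrix $\mathsf W\ne 0$ is $F$-identifiable if the only symmetric matrices $\mathsf A$ with $\operatorname{Supp}(\mathsf A)\subseteq\overline F$ and $\mathsf A\mathsf W=\mathsf W\mathsf A$ are the matrices $\lambda\mathsf W$, $\lambda\in\mathbb R$. The minimum over an empty set is $+\infty$. Conventions: $R_n(t):=1$ for $t\le0$ and $R_n(+\infty):=0$. *)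

theory Defs
  imports "HOL-Probability.Probability"
begin

text \<open>
  The index set \<open>[1,N]\<close> is a finite type \<open>'n\<close> with \<open>N = CARD('n)\<close>, so \<open>- F\<close> is the complement of
  \<open>F\<close> in \<open>[1,N]\<^sup>2\<close>. The norm of type \<^typ>\<open>real^'n^'n\<close> is the Frobenius norm (see \<open>norm_vec_def\<close>).
\<close>

definition Supp :: "real^'n^'n \<Rightarrow> ('n \<times> 'n) set" where
  "Supp A = {(i, j). A $ i $ j \<noteq> 0}"

definition sym_supp :: "('n::finite \<times> 'n) set \<Rightarrow> (real^'n^'n) set" where
  "sym_supp S = {A. transpose A = A \<and> Supp A \<subseteq> S}"

definition diag_mat :: "real^'n \<Rightarrow> real^'n^'n" where
  "diag_mat d = (\<chi> i j. if i = j then d $ i else 0)"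

text \<open>
  For symmetric \<open>W\<close> the matrix below exists by the spectral theorem and does not depend on the
  chosen diagonalization.
\<close>

definition matrix_fun :: "(real \<Rightarrow> real) \<Rightarrow> real^'n^'n \<Rightarrow> real^'n^'n" where
  "matrix_fun f W = (THE K. \<exists>U d. orthogonal_matrix U \<and>
     W = U ** diag_mat d ** transpose U \<and>
     K = U ** diag_mat (\<chi> i. f (d $ i)) ** transpose U)"

text \<open>Real analyticity on the line: a convergent power series expansion around every point.\<close>

definition analytic_on_line :: "(real \<Rightarrow> real) \<Rightarrow> bool" where
  "analytic_on_line f \<longleftrightarrow> (\<forall>x. \<exists>P. (\<lambda>h. f (x + h)) has_fps_expansion P)"

definition identifiable :: "('n::finite \<times> 'n) set \<Rightarrow> real^'n^'n \<Rightarrow> bool" where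
  "identifiable F W \<longleftrightarrow> transpose W = W \<and> W \<noteq> 0 \<and>
     {A \<in> sym_supp (- F). A ** W = W ** A} = range (\<lambda>c. c *\<^sub>R W)"

text \<open>
  The minimum of \<open>g\<close> over \<open>X\<close>, as the least element of the image rather than its infimum. It is only
  meaningful if attained; this is the case in both uses below: the commutator ratio is continuous
  and scale invariant, so its minimum is that over a compact unit sphere, and there are only
  finitely many \<open>S\<close>.
\<close>

definition min_over :: "'b set \<Rightarrow> ('b \<Rightarrow> ereal) \<Rightarrow> ereal" where
  "min_over X g = (if X = {} then \<infinity> else (LEAST m. m \<in> g ` X))"

definition min_ratio :: "real^'n^'n \<Rightarrow> ('n::finite \<times> 'n) set \<Rightarrow> ereal" where
  "min_ratio K S =
     min_over (sym_supp S - {0}) (\<lambda>A. ereal (norm (A ** K - K ** A) / norm A))"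

definition Q_crit :: "real \<Rightarrow> real^'n^'n \<Rightarrow> ('n::finite \<times> 'n) set \<Rightarrow> ereal" where
  "Q_crit l K S = min_ratio K S + ereal (l * real (card S))"

definition c0 :: "('n::finite \<times> 'n) set \<Rightarrow> real^'n^'n \<Rightarrow> ('n \<times> 'n) set \<Rightarrow> ereal" where
  "c0 F K T = min_over {S. S \<subseteq> - F \<and> S \<noteq> T \<and> card S \<le> card T} (min_ratio K)"

text \<open>
  Extension of a rate \<open>r\<close>, given on \<open>(0,\<infinity>)\<close>, to all extended reals by the conventions
  \<open>r t = 1\<close> for \<open>t \<le> 0\<close> and \<open>r \<infinity> = 0\<close>.
\<close>

definition rate_ext :: "(real \<Rightarrow> real) \<Rightarrow> ereal \<Rightarrow> real" where
  "rate_ext r t = (if t \<le> 0 then 1 else if t = \<infinity> then 0 else r (real_of_ereal t))"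

end

theory Submission
  imports Defs
begin

text \<open>
  Since \<open>f\<close> is injective, a matrix commutes with \<open>K = f(W)\<close> iff it commutes with \<open>W\<close>; hence by
  identifiability the commutator ratio of \<open>K\<close> cannot vanish on a support other than \<open>Supp W\<close> of at
  most the same size, and it does vanish at \<open>W\<close>. Replacing \<open>K\<close> by its estimate changes every ratio by at most twice
  the estimation error \<open>\<delta>\<close>. A wrong minimizer \<open>S\<close> therefore forces \<open>\<lambda> \<le> 2\<delta>\<close> if it is larger than
  \<open>Supp W\<close>, and \<open>c\<^sub>0 - 2\<delta> \<le> 2\<delta> + \<lambda>|Supp W|\<close> otherwise.
\<close>

section \<open>Spectral theorem for real symmetric matrices\<close>

lemma symmetric_inner_matrix_vector:
  fixes W :: "real^'n^'n"
  assumes "transpose W = W"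
  shows "x \<bullet> (W *v y) = (W *v x) \<bullet> y"
  using assms by (metis dot_lmul_matrix transpose_matrix_vector)

text \<open>The Rayleigh quotient attains its maximum \<open>c\<close> on the compact unit sphere of
  \<open>S\<close>. A maximizer \<open>x\<close> is an eigenvector, because moving along the
  residual \<open>W *v x - c *\<^sub>R x\<close>, which stays in \<open>S\<close> by invariance,
  would otherwise increase the quotient.\<close>

lemma symmetric_eigenvector_exists:
  fixes W :: "real^'n^'n" and S :: "(real^'n) set"
  assumes sym: "transpose W = W" and S: "subspace S" and inv: "\<And>x. x \<in> S \<Longrightarrow> W *v x \<in> S"
    and nontrivial: "S \<noteq> {0}"
  obtains x c where "x \<in> S" "norm x = 1" "W *v x = c *\<^sub>R x"
proof -
  obtain z where z: "z \<in> S" "z \<noteq> 0"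
    using nontrivial subspace_0[OF S] by blast
  have "compact (S \<inter> sphere 0 1)"
    by (simp add: closed_Int_compact closed_subspace S)
  moreover have "(1 / norm z) *\<^sub>R z \<in> S \<inter> sphere 0 1"
    using z S by (simp add: subspace_scale)
  moreover have "continuous_on (S \<inter> sphere 0 1) (\<lambda>x. x \<bullet> (W *v x))"
    by (intro continuous_intros matrix_vector_mult_linear_continuous_on)
  ultimately obtain x where x: "x \<in> S \<inter> sphere 0 1"
    and max: "\<And>y. y \<in> S \<inter> sphere 0 1 \<Longrightarrow> y \<bullet> (W *v y) \<le> x \<bullet> (W *v x)"
    using continuous_attains_sup[of "S \<inter> sphere 0 1" "\<lambda>x. x \<bullet> (W *v x)"] by blast
  define c where "c = x \<bullet> (W *v x)"
  \<comment> \<open>By homogeneity, maximality on the sphere becomes a quadratic inequality on all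
    of \<open>S\<close>.\<close>
  have le: "y \<bullet> (W *v y) \<le> c * (y \<bullet> y)" if "y \<in> S" for y
  proof (cases "y = 0")
    case False
    let ?u = "(1 / norm y) *\<^sub>R y"
    have "?u \<bullet> (W *v ?u) \<le> c"
      unfolding c_def by (rule max) (use that S False in \<open>simp add: subspace_scale\<close>)
    then have "(y \<bullet> (W *v y)) / (norm y)\<^sup>2 \<le> c"
      by (simp add: matrix_vector_mult_scaleR power2_eq_square)
    then show ?thesis
      using False by (simp add: divide_le_eq power2_norm_eq_inner)
  qed auto
  define y where "y = W *v x - c *\<^sub>R x"
  have yS: "y \<in> S"
    unfolding y_def using x inv S by (auto intro!: subspace_diff subspace_scale)
  have xx: "x \<bullet> x = 1"
    using x by (simp add: dot_square_norm)
  \<comment> \<open>This is \<open>le\<close> at \<open>x + t *\<^sub>R y\<close>: the terms of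
    order zero cancel, and the coefficient of \<open>2 * t\<close> is
    \<open>y \<bullet> (W *v x) - c * (y \<bullet> x)\<close>, which equals
    \<open>y \<bullet> y\<close>.\<close>
  have quad: "2 * t * (y \<bullet> y) \<le> t\<^sup>2 * (c * (y \<bullet> y) - y \<bullet> (W *v y))" for t
  proof -
    have "x + t *\<^sub>R y \<in> S"
      using x yS S by (auto intro!: subspace_add subspace_scale)
    then have "(x + t *\<^sub>R y) \<bullet> (W *v (x + t *\<^sub>R y)) \<le> c * ((x + t *\<^sub>R y) \<bullet> (x + t *\<^sub>R y))"
      by (rule le)
    moreover have "(x + t *\<^sub>R y) \<bullet> (W *v (x + t *\<^sub>R y))
        = c + 2 * t * (y \<bullet> (W *v x)) + t\<^sup>2 * (y \<bullet> (W *v y))"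
      using symmetric_inner_matrix_vector[OF sym, of x y]
      by (simp add: matrix_vector_right_distrib matrix_vector_mult_scaleR inner_add_left
          inner_add_right c_def inner_commute power2_eq_square algebra_simps)
    moreover have "(x + t *\<^sub>R y) \<bullet> (x + t *\<^sub>R y) = 1 + 2 * t * (y \<bullet> x) + t\<^sup>2 * (y \<bullet> y)"
      using xx by (simp add: inner_add_left inner_add_right inner_commute power2_eq_square algebra_simps)
    moreover have "y \<bullet> y = y \<bullet> (W *v x) - c * (y \<bullet> x)"
      unfolding y_def by (simp add: inner_diff_right)
    \<comment> \<open>The inner products are abstracted to real variables, which leaves pure
      algebra.\<close>
    moreover have "2 * t * s \<le> t\<^sup>2 * (c * s - p)"
      if "c + 2 * t * a + t\<^sup>2 * p \<le> c * (1 + 2 * t * b + t\<^sup>2 * s)" "s = a - c * b" for a b p s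
      using that(1) unfolding that(2) by (simp add: algebra_simps)
    ultimately show ?thesis
      by metis
  qed
  have "y \<bullet> y = 0"
  proof (rule ccontr)
    assume "y \<bullet> y \<noteq> 0"
    then have pos: "y \<bullet> y > 0"
      by simp
    define q where "q = c * (y \<bullet> y) - y \<bullet> (W *v y)"
    have q: "q \<ge> 0"
      using le[OF yS] by (simp add: q_def)
    \<comment> \<open>So small a step that the quadratic term cannot make up for the linear one; the
      summand 1 covers \<open>q = 0\<close>.\<close>
    define t where "t = (y \<bullet> y) / (q + 1)"
    have t: "t > 0" "t * q \<le> y \<bullet> y"
      using pos q by (auto simp: t_def field_simps)
    have "t * (2 * (y \<bullet> y)) \<le> t * (t * q)"
      using quad[of t] by (simp add: q_def power2_eq_square algebra_simps)
    then have "2 * (y \<bullet> y) \<le> t * q"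
      using t(1) by simp
    then show False
      using t(2) pos by linarith
  qed
  then have "W *v x = c *\<^sub>R x"
    by (simp add: y_def)
  then show thesis
    using that x by auto
qed

text \<open>Induction on the dimension: split off a unit eigenvector and continue in its orthogonal
  complement within \<open>S\<close>. Allowing any invariant subspace is what makes the induction
  hypothesis applicable there.\<close>

lemma symmetric_orthonormal_eigenbasis:
  fixes W :: "real^'n^'n" and S :: "(real^'n) set"
  assumes sym: "transpose W = W" and "subspace S" and "\<And>x. x \<in> S \<Longrightarrow> W *v x \<in> S"
  shows "\<exists>B. pairwise orthogonal B \<and> (\<forall>b\<in>B. norm b = 1 \<and> (\<exists>c. W *v b = c *\<^sub>R b)) \<and> span B = S"
  using assms(2,3)
proof (induction "dim S" arbitrary: S rule: less_induct)
  case less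
  show ?case
  proof (cases "S = {0}")
    case True
    then show ?thesis
      by (intro exI[of _ "{}"]) auto
  next
    case False
    obtain x c where x: "x \<in> S" "norm x = 1" "W *v x = c *\<^sub>R x"
      using symmetric_eigenvector_exists[OF sym less.prems False] by blast
    have xx: "x \<bullet> x = 1"
      using x(2) by (simp add: dot_square_norm)
    define T where "T = S \<inter> {y. x \<bullet> y = 0}"
    have T: "subspace T"
      unfolding T_def by (intro subspace_inter less.prems(1) subspace_hyperplane)
    \<comment> \<open>Symmetry moves \<open>W\<close> onto the eigenvector \<open>x\<close>, so
      orthogonality to \<open>x\<close> is preserved.\<close>
    have invT: "W *v y \<in> T" if "y \<in> T" for y
      using that less.prems(2) x(3) symmetric_inner_matrix_vector[OF sym, of x y]
      by (simp add: T_def)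
    have "x \<notin> T"
      using xx by (simp add: T_def)
    then have "T \<subset> S"
      using x(1) unfolding T_def by blast
    then have "dim T < dim S"
      using T less.prems(1) by (intro dim_psubset) (simp add: span_eq_iff[THEN iffD2])
    from less.hyps[OF this T invT] obtain B where B: "pairwise orthogonal B"
      "\<forall>b\<in>B. norm b = 1 \<and> (\<exists>c. W *v b = c *\<^sub>R b)" "span B = T"
      by blast
    have orth: "x \<bullet> b = 0" if "b \<in> B" for b
      using B(3) that span_base by (fastforce simp: T_def)
    have "span (insert x B) = S"
    proof
      have "B \<subseteq> S"
        using B(3) span_superset by (fastforce simp: T_def)
      then show "span (insert x B) \<subseteq> S"
        using x(1) less.prems(1) by (intro span_minimal) auto
      show "S \<subseteq> span (insert x B)"
      proof
        fix s assume s: "s \<in> S"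
        have "s - (x \<bullet> s) *\<^sub>R x \<in> T"
          using s x(1) less.prems(1) xx
          by (auto simp: T_def inner_diff_right intro!: subspace_diff subspace_scale)
        then show "s \<in> span (insert x B)"
          unfolding span_breakdown_eq using B(3) by blast
      qed
    qed
    moreover have "pairwise orthogonal (insert x B)"
      using B(1) orth by (auto simp: pairwise_insert orthogonal_def inner_commute)
    ultimately show ?thesis
      using B(2) x(2,3) by (intro exI[of _ "insert x B"]) auto
  qed
qed

lemma matrix_mult_diag_mat_nth: "(A ** diag_mat d) $ i $ j = A $ i $ j * d $ j"
  by (simp add: matrix_matrix_mult_def diag_mat_def if_distrib cong: if_cong)

lemma diag_mat_mult_nth: "(diag_mat d ** A) $ i $ j = d $ i * A $ i $ j"
  by (simp add: matrix_matrix_mult_def diag_mat_def if_distrib if_distribR cong: if_cong)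

text \<open>An orthonormal eigenbasis of the whole space has \<open>CARD('n)\<close> elements, so it
  can be indexed by \<open>'n\<close> and placed in the columns of \<open>U\<close>.\<close>

theorem symmetric_diagonalizable:
  fixes W :: "real^'n^'n"
  assumes sym: "transpose W = W"
  obtains U d where "orthogonal_matrix U" "W = U ** diag_mat d ** transpose U"
proof -
  obtain B where B: "pairwise orthogonal B"
      "\<forall>b\<in>B. norm b = 1 \<and> (\<exists>c. W *v b = c *\<^sub>R b)" "span B = (UNIV :: (real^'n) set)"
    using symmetric_orthonormal_eigenbasis[OF sym subspace_UNIV] by auto
  have "0 \<notin> B"
    using B(2) by force
  then have "independent B"
    by (rule pairwise_orthogonal_independent[OF B(1)])
  then have "finite B" "card B = CARD('n)"
    using B(3) independent_imp_finite dim_span_eq_card_independent by (fastforce, fastforce)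
  then obtain b where b: "bij_betw b (UNIV :: 'n set) B"
    by (metis finite_class.finite_UNIV finite_same_card_bij)
  then have bB: "b j \<in> B" for j
    by (auto simp: bij_betw_def)
  have "\<forall>j. \<exists>c. W *v b j = c *\<^sub>R b j"
    using B(2) bB by blast
  from choice[OF this] obtain d' where d': "\<And>j. W *v b j = d' j *\<^sub>R b j"
    by blast
  define U :: "real^'n^'n" where "U = (\<chi> i j. b j $ i)"
  define d :: "real^'n" where "d = (\<chi> j. d' j)"
  have col: "column j U = b j" for j
    by (simp add: U_def column_def)
  have U: "orthogonal_matrix U"
    unfolding orthogonal_matrix_orthonormal_columns col
    using B(1,2) bB b unfolding pairwise_def bij_betw_def inj_on_def by blast
  have "(W ** U) $ i $ j = (U ** diag_mat d) $ i $ j" for i j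
  proof -
    have "(W ** U) $ i $ j = (W *v b j) $ i"
      by (simp add: matrix_matrix_mult_def matrix_vector_mult_def U_def)
    then show ?thesis
      by (simp add: d' matrix_mult_diag_mat_nth U_def d_def)
  qed
  then have "W ** U = U ** diag_mat d"
    by (simp add: vec_eq_iff)
  then have "W ** (U ** transpose U) = U ** diag_mat d ** transpose U"
    by (simp add: matrix_mul_assoc)
  then show thesis
    using that U by (simp add: orthogonal_matrix_def)
qed

section \<open>Functions of symmetric matrices\<close>

text \<open>
  In the eigenbases the intertwining relation reads \<open>B\<^sub>i\<^sub>j e\<^sub>j = d\<^sub>i B\<^sub>i\<^sub>j\<close>, so \<open>B\<^sub>i\<^sub>j\<close> vanishes unless
  \<open>e\<^sub>j = d\<^sub>i\<close>, and \<open>f\<close> can be applied to both sides.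
\<close>

lemma intertwine_matrix_fun:
  fixes A U V :: "real^'n^'n"
  assumes U: "orthogonal_matrix U" and V: "orthogonal_matrix V"
    and eq: "A ** (V ** diag_mat e ** transpose V) = (U ** diag_mat d ** transpose U) ** A"
  shows "A ** (V ** diag_mat (\<chi> i. f (e $ i)) ** transpose V)
       = (U ** diag_mat (\<chi> i. f (d $ i)) ** transpose U) ** A"
proof -
  define B where "B = transpose U ** A ** V"
  have UU: "transpose U ** U = mat 1" "U ** transpose U = mat 1"
    and VV: "transpose V ** V = mat 1" "V ** transpose V = mat 1"
    using U V by (auto simp: orthogonal_matrix_def)
  have AB: "A ** V = U ** B" "B ** transpose V = transpose U ** A"
    unfolding B_def by (metis UU VV matrix_mul_assoc matrix_mul_lid matrix_mul_rid)+
  have "B ** diag_mat e = transpose U ** (A ** (V ** diag_mat e ** transpose V)) ** V"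
    unfolding B_def by (metis VV matrix_mul_assoc matrix_mul_rid)
  also have "\<dots> = diag_mat d ** B"
    unfolding B_def eq by (metis UU matrix_mul_assoc matrix_mul_lid)
  finally have "B $ i $ j * e $ j = d $ i * B $ i $ j" for i j
    by (metis diag_mat_mult_nth matrix_mult_diag_mat_nth)
  then have "B $ i $ j * f (e $ j) = f (d $ i) * B $ i $ j" for i j
    by (metis mult.commute mult_cancel_left)
  then have *: "B ** diag_mat (\<chi> i. f (e $ i)) = diag_mat (\<chi> i. f (d $ i)) ** B"
    by (simp add: vec_eq_iff diag_mat_mult_nth matrix_mult_diag_mat_nth)
  have "A ** (V ** diag_mat (\<chi> i. f (e $ i)) ** transpose V)
      = U ** (B ** diag_mat (\<chi> i. f (e $ i))) ** transpose V"
    by (simp add: matrix_mul_assoc AB)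
  also have "\<dots> = U ** diag_mat (\<chi> i. f (d $ i)) ** (B ** transpose V)"
    unfolding * by (simp add: matrix_mul_assoc)
  finally show ?thesis
    by (simp add: matrix_mul_assoc AB)
qed

text \<open>Intertwining two diagonalizations of \<open>W\<close> by the identity matrix shows that
  they yield the same result, so the definite description in \<open>matrix_fun\<close> is well
  defined.\<close>

lemma matrix_fun_eq:
  fixes U :: "real^'n^'n"
  assumes U: "orthogonal_matrix U" and W: "W = U ** diag_mat d ** transpose U"
  shows "matrix_fun f W = U ** diag_mat (\<chi> i. f (d $ i)) ** transpose U"
  unfolding matrix_fun_def
proof (rule the_equality)
  show "\<exists>V e. orthogonal_matrix V \<and> W = V ** diag_mat e ** transpose V \<and>
      U ** diag_mat (\<chi> i. f (d $ i)) ** transpose U = V ** diag_mat (\<chi> i. f (e $ i)) ** transpose V"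
    using assms by blast
next
  fix K
  assume "\<exists>V e. orthogonal_matrix V \<and> W = V ** diag_mat e ** transpose V \<and>
      K = V ** diag_mat (\<chi> i. f (e $ i)) ** transpose V"
  then obtain V e where "orthogonal_matrix V" "W = V ** diag_mat e ** transpose V"
    and K: "K = V ** diag_mat (\<chi> i. f (e $ i)) ** transpose V"
    by blast
  then show "K = U ** diag_mat (\<chi> i. f (d $ i)) ** transpose U"
    using intertwine_matrix_fun[OF U, of V "mat 1" e d f] W by simp
qed

text \<open>Commuting is intertwining with a single basis. One direction applies \<open>f\<close> to
  the eigenvalues of \<open>W\<close>; the other applies \<open>inv f\<close> to those of
  \<open>matrix_fun f W\<close>, which injectivity sends back to the original ones.\<close>

lemma commute_matrix_fun_iff:
  fixes W :: "real^'n^'n"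
  assumes sym: "transpose W = W" and f: "inj f"
  shows "A ** matrix_fun f W = matrix_fun f W ** A \<longleftrightarrow> A ** W = W ** A"
proof -
  obtain U d where U: "orthogonal_matrix U" and W: "W = U ** diag_mat d ** transpose U"
    using symmetric_diagonalizable[OF sym] by blast
  show ?thesis
    using intertwine_matrix_fun[OF U U, of A d d f]
      intertwine_matrix_fun[OF U U, of A "\<chi> i. f (d $ i)" "\<chi> i. f (d $ i)" "inv f"] f
    unfolding matrix_fun_eq[OF U W] by (auto simp: W)
qed

section \<open>The Frobenius norm and the commutator ratio\<close>

lemma norm_transpose:
  fixes A :: "real^'n^'m"
  shows "norm (transpose A) = norm A"
proof -
  have "transpose A \<bullet> transpose A = A \<bullet> A"
    unfolding inner_vec_def by (simp add: transpose_def) (rule sum.swap)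
  then show ?thesis
    by (simp add: norm_eq_sqrt_inner)
qed

text \<open>Each entry of the product is an inner product of a row of \<open>A\<close> with a column
  of \<open>B\<close>. Cauchy-Schwarz bounds it by a product of norms, and the sums over rows and
  columns then factor.\<close>

lemma norm_matrix_mult_le:
  fixes A :: "real^'n^'m" and B :: "real^'k^'n"
  shows "norm (A ** B) \<le> norm A * norm B"
proof -
  have row: "norm ((A ** B) $ i) \<le> norm (A $ i) * norm (transpose B)" for i
  proof -
    have "norm ((A ** B) $ i $ j) \<le> norm (A $ i) * norm (transpose B $ j)" for j
    proof -
      have "(A ** B) $ i $ j = A $ i \<bullet> transpose B $ j"
        by (simp add: matrix_matrix_mult_def inner_vec_def transpose_def)
      then show ?thesis
        by (simp add: Cauchy_Schwarz_ineq2)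
    qed
    then have "norm ((A ** B) $ i) \<le> L2_set (\<lambda>j. norm (A $ i) * norm (transpose B $ j)) UNIV"
      unfolding norm_vec_def[of "(A ** B) $ i"] by (intro L2_set_mono) auto
    then show ?thesis
      by (simp add: L2_set_right_distrib norm_vec_def[of "transpose B"])
  qed
  have "norm (A ** B) \<le> L2_set (\<lambda>i. norm (A $ i) * norm (transpose B)) UNIV"
    unfolding norm_vec_def[of "A ** B"] by (intro L2_set_mono row) auto
  also have "\<dots> = norm A * norm (transpose B)"
    by (simp add: L2_set_left_distrib norm_vec_def[of A])
  finally show ?thesis
    by (simp add: norm_transpose)
qed

text \<open>The objective of \<open>min_ratio\<close> before its embedding into
  \<open>ereal\<close>, so that continuity and estimates can be handled over the reals.\<close>

definition comm_ratio :: "real^'n^'n \<Rightarrow> real^'n^'n \<Rightarrow> real" where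
  "comm_ratio K A = norm (A ** K - K ** A) / norm A"

lemma comm_ratio_nonneg: "comm_ratio K A \<ge> 0"
  by (simp add: comm_ratio_def)

lemma comm_ratio_scaleR: "c \<noteq> 0 \<Longrightarrow> comm_ratio K (c *\<^sub>R A) = comm_ratio K A"
  by (simp add: comm_ratio_def scalar_matrix_assoc[symmetric] matrix_scalar_ac
      scaleR_diff_right[symmetric])

text \<open>The commutator is linear in its second argument, so the change is the commutator of
  \<open>A\<close> with \<open>K - L\<close>. Its two products each cost
  \<open>norm A * norm (K - L)\<close>, and the division removes \<open>norm A\<close>.\<close>

lemma comm_ratio_perturb:
  fixes K L :: "real^'n^'n"
  assumes "A \<noteq> 0"
  shows "comm_ratio K A \<le> comm_ratio L A + 2 * norm (K - L)"
proof -
  have "A ** K - K ** A = (A ** L - L ** A) + (A ** (K - L) - (K - L) ** A)"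
    by (simp add: matrix_matrix_mult_def vec_eq_iff sum_subtractf algebra_simps)
  then have "norm (A ** K - K ** A)
      \<le> norm (A ** L - L ** A) + norm (A ** (K - L) - (K - L) ** A)"
    by (metis norm_triangle_ineq)
  also have "norm (A ** (K - L) - (K - L) ** A) \<le> norm (A ** (K - L)) + norm ((K - L) ** A)"
    by (rule norm_triangle_ineq4)
  also have "\<dots> \<le> 2 * norm (K - L) * norm A"
    using norm_matrix_mult_le[of A "K - L"] norm_matrix_mult_le[of "K - L" A]
    by (simp add: mult.commute)
  finally show ?thesis
    using assms by (simp add: comm_ratio_def field_simps)
qed

section \<open>Attained minima\<close>

lemma min_over_attained:
  assumes "x \<in> X" and "\<And>y. y \<in> X \<Longrightarrow> g x \<le> g y"
  shows "min_over X g = g x"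
  using assms unfolding min_over_def by (auto intro!: Least_equality)

lemma min_over_finite:
  assumes "finite X" "X \<noteq> {}"
  obtains x where "x \<in> X" "min_over X g = g x" "\<And>y. y \<in> X \<Longrightarrow> g x \<le> g y"
proof -
  have "Min (g ` X) \<in> g ` X"
    using assms by simp
  then obtain x where x: "x \<in> X" "g x = Min (g ` X)"
    by (metis imageE)
  then have "g x \<le> g y" if "y \<in> X" for y
    using assms that by simp
  then show thesis
    using that x(1) min_over_attained by metis
qed

lemma subspace_sym_supp: "subspace (sym_supp S)"
proof -
  have "sym_supp S = {A. transpose A = A \<and> (\<forall>i j. (i, j) \<notin> S \<longrightarrow> A $ i $ j = 0)}"
    by (auto simp: sym_supp_def Supp_def)
  then show ?thesis
    by (auto simp: subspace_def transpose_def vec_eq_iff)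
qed

text \<open>Scale invariance reduces the problem to the unit sphere of the subspace
  \<open>sym_supp S\<close>, which is compact.\<close>

lemma min_ratio_attained:
  fixes K :: "real^'n^'n"
  assumes "sym_supp S - {0} \<noteq> {}"
  obtains A where "A \<in> sym_supp S" "A \<noteq> 0" "min_ratio K S = ereal (comm_ratio K A)"
    "\<And>B. B \<in> sym_supp S \<Longrightarrow> B \<noteq> 0 \<Longrightarrow> comm_ratio K A \<le> comm_ratio K B"
proof -
  let ?X = "sym_supp S \<inter> sphere 0 1"
  obtain Z where Z: "Z \<in> sym_supp S" "Z \<noteq> 0"
    using assms by blast
  have unit: "(1 / norm B) *\<^sub>R B \<in> ?X" if "B \<in> sym_supp S" "B \<noteq> 0" for B
    using that by (simp add: subspace_scale subspace_sym_supp)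
  have "compact ?X"
    by (simp add: closed_Int_compact closed_subspace subspace_sym_supp)
  moreover have "?X \<noteq> {}"
    using unit[OF Z] by blast
  \<comment> \<open>The denominator does not vanish on the unit sphere.\<close>
  moreover have "continuous_on ?X (comm_ratio K)"
    unfolding comm_ratio_def matrix_matrix_mult_def
    by (intro continuous_intros) auto
  ultimately obtain A where A: "A \<in> ?X" and min: "\<And>B. B \<in> ?X \<Longrightarrow> comm_ratio K A \<le> comm_ratio K B"
    using continuous_attains_inf by metis
  have le: "comm_ratio K A \<le> comm_ratio K B" if "B \<in> sym_supp S" "B \<noteq> 0" for B
    using min[OF unit[OF that]] that(2) by (simp add: comm_ratio_scaleR)
  have "A \<noteq> 0"
    using A by auto
  moreover have "min_ratio K S = ereal (comm_ratio K A)"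
    unfolding min_ratio_def comm_ratio_def[symmetric]
    by (rule min_over_attained) (use A \<open>A \<noteq> 0\<close> le in auto)
  ultimately show thesis
    using that A le by blast
qed

lemma min_ratio_nonneg: "min_ratio K S \<ge> 0"
proof (cases "sym_supp S - {0} = {}")
  case True
  then show ?thesis
    by (simp add: min_ratio_def min_over_def)
next
  case False
  then show ?thesis
    by (rule min_ratio_attained[of S K]) (simp add: comm_ratio_nonneg)
qed

lemma min_ratio_le:
  assumes "A \<in> sym_supp S" "A \<noteq> 0"
  shows "min_ratio K S \<le> ereal (comm_ratio K A)"
proof -
  have "sym_supp S - {0} \<noteq> {}"
    using assms by blast
  then show ?thesis
    by (rule min_ratio_attained[of S K]) (use assms in simp)
qed

text \<open>A minimizer for \<open>L\<close> is a competitor for \<open>K\<close>. If there is no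
  nonzero candidate, both minima are infinite.\<close>

lemma min_ratio_perturb:
  fixes K L :: "real^'n^'n"
  shows "min_ratio K S \<le> min_ratio L S + ereal (2 * norm (K - L))"
proof (cases "sym_supp S - {0} = {}")
  case True
  then show ?thesis
    by (simp add: min_ratio_def min_over_def)
next
  case False
  then obtain A where A: "A \<in> sym_supp S" "A \<noteq> 0" "min_ratio L S = ereal (comm_ratio L A)"
    using min_ratio_attained by metis
  have "min_ratio K S \<le> ereal (comm_ratio K A)"
    using A by (intro min_ratio_le)
  also have "\<dots> \<le> ereal (comm_ratio L A + 2 * norm (K - L))"
    using comm_ratio_perturb[OF A(2)] by simp
  finally show ?thesis
    by (simp add: A(3))
qed

section \<open>The separation constant \<open>c0\<close> under identifiability\<close>

lemma c0_le:
  assumes "S \<subseteq> - F" "S \<noteq> T" "card S \<le> card T"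
  shows "c0 F K T \<le> min_ratio K S"
proof -
  let ?X = "{S. S \<subseteq> - F \<and> S \<noteq> T \<and> card S \<le> card T}"
  have "finite ?X" "S \<in> ?X" "?X \<noteq> {}"
    using assms by auto
  then show ?thesis
    unfolding c0_def using min_over_finite[of ?X "min_ratio K" "min_over ?X (min_ratio K) \<le> min_ratio K S"]
    by force
qed

text \<open>Such an \<open>A\<close> is a multiple of \<open>W\<close>, and the factor is nonzero
  because \<open>A\<close> is.\<close>

lemma identifiable_Supp:
  assumes "identifiable F W" "A \<in> sym_supp (- F)" "A \<noteq> 0" "A ** W = W ** A"
  shows "Supp A = Supp W"
proof -
  have "A \<in> range (\<lambda>c. c *\<^sub>R W)"
    using assms unfolding identifiable_def by blast
  then show ?thesis
    using assms(3) by (auto simp: Supp_def)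
qed

text \<open>A minimum over finitely many supports is positive once each value is. A vanishing ratio
  would give a nonzero matrix supported in \<open>S\<close> and commuting with
  \<open>W\<close>.\<close>

lemma c0_pos:
  fixes W :: "real^'n^'n"
  assumes id: "identifiable F W" and f: "inj f"
  shows "c0 F (matrix_fun f W) (Supp W) > 0"
proof -
  let ?X = "{S. S \<subseteq> - F \<and> S \<noteq> Supp W \<and> card S \<le> card (Supp W)}" and ?K = "matrix_fun f W"
  have pos: "min_ratio ?K S > 0" if S: "S \<in> ?X" for S
  proof (cases "sym_supp S - {0} = {}")
    case True
    then show ?thesis
      by (simp add: min_ratio_def min_over_def)
  next
    case False
    then obtain A where A: "A \<in> sym_supp S" "A \<noteq> 0" "min_ratio ?K S = ereal (comm_ratio ?K A)"
      using min_ratio_attained by metis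
    have "comm_ratio ?K A \<noteq> 0"
    proof
      assume "comm_ratio ?K A = 0"
      then have "A ** ?K = ?K ** A"
        using A(2) by (simp add: comm_ratio_def)
      then have "A ** W = W ** A"
        using commute_matrix_fun_iff[OF _ f] id by (auto simp: identifiable_def)
      moreover have "A \<in> sym_supp (- F)"
        using A(1) S by (auto simp: sym_supp_def)
      ultimately have "Supp A = Supp W"
        using identifiable_Supp[OF id] A(2) by blast
      then have "Supp W \<subseteq> S"
        using A(1) by (simp add: sym_supp_def)
      \<comment> \<open>Inclusion together with the cardinality bound forces
        \<open>S = Supp W\<close>, which is excluded.\<close>
      then show False
        using S card_seteq[of S "Supp W"] by auto
    qed
    then show ?thesis
      using A(3) comm_ratio_nonneg[of ?K A] by simp
  qed
  show ?thesis
  proof (cases "?X = {}")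
    case True
    then show ?thesis
      unfolding c0_def min_over_def by simp
  next
    case False
    obtain S where "S \<in> ?X" "min_over ?X (min_ratio ?K) = min_ratio ?K S"
      by (rule min_over_finite[OF finite False, of "min_ratio ?K"])
    then show ?thesis
      unfolding c0_def using pos by simp
  qed
qed

section \<open>The error bound\<close>

text \<open>The deterministic core, for one outcome with estimate \<open>L\<close>. The factor 4
  collects two perturbations of size \<open>2 * norm (L - K)\<close>: one for the competitor
  \<open>W\<close> on its own support, one for passing from \<open>L\<close> to \<open>K\<close> on
  the selected \<open>S\<close>.\<close>

lemma selection_error_imp_deviation:
  fixes W L :: "real^'n^'n" and f :: "real \<Rightarrow> real"
  defines "K \<equiv> matrix_fun f W"
  assumes id: "identifiable F W" and f: "inj f" and WF: "Supp W \<subseteq> - F"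
    and l: "l > 0" and arg: "is_arg_min (Q_crit l L) (\<lambda>S. S \<subseteq> - F) S" and ne: "S \<noteq> Supp W"
  shows "norm (L - K) \<ge> l / 2
    \<or> c0 F K (Supp W) - ereal (l * real (card (Supp W))) \<le> ereal (4 * norm (L - K))"
proof -
  let ?T = "Supp W" and ?\<delta> = "norm (L - K)"
  have S: "S \<subseteq> - F" and "\<not> Q_crit l L ?T < Q_crit l L S"
    using arg WF by (auto simp: is_arg_min_def)
  then have le: "Q_crit l L S \<le> Q_crit l L ?T"
    by simp
  have W: "transpose W = W" "W \<noteq> 0"
    using id by (auto simp: identifiable_def)
  have WK: "comm_ratio K W = 0"
    using commute_matrix_fun_iff[OF W(1) f, of W] by (simp add: comm_ratio_def K_def)
  have "min_ratio L ?T \<le> ereal (comm_ratio L W)"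
    using W by (intro min_ratio_le) (auto simp: sym_supp_def)
  also have "\<dots> \<le> ereal (2 * ?\<delta>)"
    using comm_ratio_perturb[OF W(2), of L K] WK by simp
  finally have "Q_crit l L ?T \<le> ereal (2 * ?\<delta>) + ereal (l * real (card ?T))"
    unfolding Q_crit_def by (rule add_right_mono)
  with le have QS: "min_ratio L S + ereal (l * real (card S)) \<le> ereal (2 * ?\<delta> + l * real (card ?T))"
    unfolding Q_crit_def by simp
  \<comment> \<open>The finite upper bound rules out the value \<open>\<infinity>\<close>, so
    \<open>S\<close> carries a nonzero matrix.\<close>
  then obtain m where m: "min_ratio L S = ereal m" and "m \<ge> 0"
    using min_ratio_nonneg[of L S] by (cases "min_ratio L S") auto
  have m_le: "m + l * real (card S) \<le> 2 * ?\<delta> + l * real (card ?T)"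
    using QS m by simp
  show ?thesis
  proof (cases "card S \<le> card ?T")
    case False
    \<comment> \<open>Cardinalities are integers, so a larger support pays at least one additional
      penalty \<open>l\<close>.\<close>
    then have "l * (real (card ?T) + 1) \<le> l * real (card S)"
      using l by (intro mult_left_mono) auto
    then show ?thesis
      using m_le \<open>m \<ge> 0\<close> by (simp add: algebra_simps)
  next
    case True
    have "c0 F K ?T \<le> min_ratio K S"
      using S ne True by (rule c0_le)
    also have "\<dots> \<le> ereal (m + 2 * ?\<delta>)"
      using min_ratio_perturb[of K S L] m by (simp add: norm_minus_commute)
    also have "\<dots> \<le> ereal (4 * ?\<delta> + l * real (card ?T))"
    proof -
      have "0 \<le> l * real (card S)"
        using l by simp
      then show ?thesis
        using m_le by simp
    qed
    finally show ?thesis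
      by (cases "c0 F K ?T") auto
  qed
qed

text \<open>The deterministic dichotomy becomes an inclusion of events, to which the union bound and
  the tail bound apply. The cases for \<open>b\<close> follow the conventions in
  \<open>rate_ext\<close>.\<close>

theorem theorem7:
  fixes W K :: "real^'n^'n"
    and F Sstar :: "('n::finite \<times> 'n) set"
    and f :: "real \<Rightarrow> real"
    and M :: "'a measure"
    and Khat :: "nat \<Rightarrow> 'a \<Rightarrow> real^'n^'n"
    and R :: "nat \<Rightarrow> real \<Rightarrow> real"
    and lam :: "nat \<Rightarrow> real"
    and Shat :: "nat \<Rightarrow> 'a \<Rightarrow> ('n \<times> 'n) set"
  assumes "transpose W = W"
    and "\<forall>(i, j) \<in> F. W $ i $ j = 0"
    and "inj f" and "analytic_on_line f"
    and "K = matrix_fun f W"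
    and "Sstar = Supp W"
    and "prob_space M"
    and "\<And>n. n \<ge> 1 \<Longrightarrow> Khat n \<in> borel_measurable M"
    and "\<And>n t. n \<ge> 1 \<Longrightarrow> t > 0 \<Longrightarrow>
           measure M {\<omega> \<in> space M. norm (Khat n \<omega> - K) \<ge> t} \<le> R n t"
    and "\<And>n. n \<ge> 1 \<Longrightarrow> antimono_on {0<..} (R n)"
    and "\<And>t. t > 0 \<Longrightarrow> (\<lambda>n. R n t) \<longlonglongrightarrow> 0"
    and "\<And>n. n \<ge> 1 \<Longrightarrow> lam n > 0"
    and "\<And>n. n \<ge> 1 \<Longrightarrow> Shat n \<in> measurable M (count_space UNIV)"
    and "\<And>n \<omega>. n \<ge> 1 \<Longrightarrow> \<omega> \<in> space M \<Longrightarrow>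
           is_arg_min (Q_crit (lam n) (Khat n \<omega>)) (\<lambda>S. S \<subseteq> - F) (Shat n \<omega>)"
    and "identifiable F W"
  shows "c0 F K Sstar > 0 \<and>
    (\<forall>n\<ge>1. measure M {\<omega> \<in> space M. Shat n \<omega> \<noteq> Sstar}
       \<le> rate_ext (R n) ((c0 F K Sstar - ereal (lam n * real (card Sstar))) / 4)
         + rate_ext (R n) (ereal (lam n / 2)))"
proof (intro conjI allI impI)
  show "c0 F K Sstar > 0"
    using c0_pos assms(3,5,6,15) by blast
next
  fix n :: nat assume n: "n \<ge> 1"
  interpret prob_space M
    by fact
  define bad where "bad t = {\<omega> \<in> space M. norm (Khat n \<omega> - K) \<ge> t}" for t
  define b where "b = (c0 F K Sstar - ereal (lam n * real (card Sstar))) / 4"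
  let ?E = "{\<omega> \<in> space M. Shat n \<omega> \<noteq> Sstar}"
  have meas [measurable]: "Khat n \<in> borel_measurable M"
    using assms(8) n .
  have bad_sets: "bad t \<in> sets M" for t
    unfolding bad_def by measurable
  have lam: "lam n > 0"
    using assms(12) n .
  have WF: "Supp W \<subseteq> - F"
    using assms(2) by (auto simp: Supp_def)
  \<comment> \<open>A rate bounds a probability. This matters when the first term is 1 and the
    second must not lower the sum.\<close>
  have rate_nonneg: "R n t \<ge> 0" if "t > 0" for t
    using assms(9)[OF n that] measure_nonneg order_trans by blast
  have err: "lam n / 2 \<le> norm (Khat n \<omega> - K) \<or> b \<le> ereal (norm (Khat n \<omega> - K))"
    if "\<omega> \<in> ?E" for \<omega>
  proof -
    have "lam n / 2 \<le> norm (Khat n \<omega> - K) \<or>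
        c0 F K Sstar - ereal (lam n * real (card Sstar)) \<le> ereal (4 * norm (Khat n \<omega> - K))"
      using selection_error_imp_deviation[OF assms(15,3) WF lam assms(14)[OF n]] that
      unfolding assms(5,6) by blast
    then show ?thesis
      unfolding b_def by (cases "c0 F K Sstar") (auto simp: ereal_divide)
  qed
  have half: "rate_ext (R n) (ereal (lam n / 2)) = R n (lam n / 2)"
    using lam by (simp add: rate_ext_def)
  have prob_half: "prob (bad (lam n / 2)) \<le> R n (lam n / 2)"
    unfolding bad_def by (intro assms(9) n) (use lam in simp)
  show "prob ?E \<le> rate_ext (R n) b + rate_ext (R n) (ereal (lam n / 2))"
  proof (cases "b \<le> 0")
    case True
    then show ?thesis
      using half rate_nonneg[of "lam n / 2"] lam prob_le_1[of ?E]
      by (simp add: rate_ext_def add_increasing2)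
  next
    case False
    show ?thesis
    proof (cases "b = \<infinity>")
      case True
      \<comment> \<open>An infinite \<open>b\<close> leaves only the first alternative of
        \<open>err\<close>, in agreement with the value 0 of \<open>rate_ext\<close> at
        infinity.\<close>
      then have "?E \<subseteq> bad (lam n / 2)"
        using err unfolding bad_def by auto
      then have "prob ?E \<le> prob (bad (lam n / 2))"
        by (rule finite_measure_mono) (rule bad_sets)
      then show ?thesis
        using prob_half half True by (simp add: rate_ext_def)
    next
      case False
      with \<open>\<not> b \<le> 0\<close> obtain t where t: "b = ereal t" "t > 0"
        by (cases b) auto
      have "?E \<subseteq> bad t \<union> bad (lam n / 2)"
        using err unfolding bad_def t by auto
      then have "prob ?E \<le> prob (bad t \<union> bad (lam n / 2))"
        by (rule finite_measure_mono) (intro sets.Un bad_sets)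
      also have "\<dots> \<le> prob (bad t) + prob (bad (lam n / 2))"
        by (intro measure_Un_le bad_sets)
      also have "\<dots> \<le> R n t + R n (lam n / 2)"
        using prob_half assms(9)[OF n t(2)] unfolding bad_def by simp
      finally show ?thesis
        using half t by (simp add: rate_ext_def)
    qed
  qed
qed

end
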